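(* In any normed plane the following holds. (1) An ellipse defined by its foci is always an ellipse defined by its leading circle and a focus, and the converse statement is also true: an ellipse defined by its leading circle and a focus is always an ellipse defined by its foci. (2) An ellipse defined by its leading line and a focus is not necessarily an ellipse defined by its foci: there exist a normed plane and, in it, an ellipse defined by its leading line and a focus which is not an ellipse defined by its foci. (3) Conversely, an ellipse defined by its foci is not necessarily an ellipse defined by its leading line and a focus: there exist a normed plane and, in it, an ellipse defined by its foci which is not an ellipse defined by its leading line and a focus.
   Context: A normed plane $X$ is the real affine plane (with origin $\mathbf 0$) equipped with a norm $\|\cdot\|$; its unit ball (unit disk) is $K=\{\mathbf x\in X:\|\mathbf x\|\le 1\}$. Ellipse defined by its foci: for $\mathbf x,\mathbf y\in X$ with $\mathbf x\neq\mathbf y$ and $2a\ge 2c=\|\mathbf x-\mathbf y\|$, the set $E(\mathbf x,\mathbf y,a)=\{\mathbf z\in X:\|\mathbf z-\mathbf x\|+\|\mathbf z-\mathbf y\|=2a\}$. Ellipse defined by its leading circle and its focus $\mathbf x$: let $L=(2a)\cdot K$ be a homothetic copy of the unit disk $K$ and let $\mathbf x\in L$ be an arbitrary point of it; the ellipse is the locus of points $\mathbf z\in X$ for which there is a positive $\varepsilon$ such that $\mathbf z+\varepsilon K$ touches $L$ and contains $\mathbf x$ on its boundary. Two disks touch if their boundaries have a common point and either their interiors are disjoint or one of the disks contains the other. Ellipse defined by its leading line and its focus $\mathbf x$: let $l$ be a straight line, $\mathbf x$ a point, and $\gamma=\frac{a}{c}$ a ratio larger than $1$; the ellipse is the locus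 of points $\mathbf z\in X$ for which there is a positive $\varepsilon$ such that the boundary of the disk $\mathbf z+\varepsilon K$ contains $\mathbf x$ and the disk $\mathbf z+\gamma(\varepsilon K)$ touches the line $l$ (that is, the disk meets $l$ but its interior does not).
   Formalization: In (1) the foci ellipse is taken with a > c, and the focus x lies in the interior of L and differs from its centre; the claim fails for a = c and for x on the boundary of L, and for x the centre the locus is shown to be the ellipse with coinciding foci. *)

theory Defs
  imports "HOL-Analysis.Analysis"
begin

text \<open>
  A normed plane is \<^typ>\<open>real^2\<close> together with an arbitrary norm \<open>N\<close>, given as a function so that
  one can quantify over all normed planes. All norms on \<^typ>\<open>real^2\<close> induce the standard topology, so
  \<^const>\<open>interior\<close> and \<^const>\<open>frontier\<close> are the interior and boundary in every normed plane.
\<close>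

definition is_norm :: "(real^2 \<Rightarrow> real) \<Rightarrow> bool" where
  "is_norm N \<longleftrightarrow>
     (\<forall>x. N x = 0 \<longleftrightarrow> x = 0) \<and>
     (\<forall>c x. N (c *\<^sub>R x) = \<bar>c\<bar> * N x) \<and>
     (\<forall>x y. N (x + y) \<le> N x + N y)"

definition unit_disk :: "(real^2 \<Rightarrow> real) \<Rightarrow> (real^2) set" where
  "unit_disk N = {x. N x \<le> 1}"

definition disk :: "(real^2 \<Rightarrow> real) \<Rightarrow> real^2 \<Rightarrow> real \<Rightarrow> (real^2) set" where
  "disk N p r = (\<lambda>k. p + r *\<^sub>R k) ` unit_disk N"

definition disks_touch :: "(real^2) set \<Rightarrow> (real^2) set \<Rightarrow> bool" where
  "disks_touch A B \<longleftrightarrow>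
     frontier A \<inter> frontier B \<noteq> {} \<and> (interior A \<inter> interior B = {} \<or> A \<subseteq> B \<or> B \<subseteq> A)"

definition disk_touches_line :: "(real^2) set \<Rightarrow> (real^2) set \<Rightarrow> bool" where
  "disk_touches_line A l \<longleftrightarrow> A \<inter> l \<noteq> {} \<and> interior A \<inter> l = {}"

definition is_line :: "(real^2) set \<Rightarrow> bool" where
  "is_line l \<longleftrightarrow> affine l \<and> aff_dim l = 1"

definition foci_locus :: "(real^2 \<Rightarrow> real) \<Rightarrow> real^2 \<Rightarrow> real^2 \<Rightarrow> real \<Rightarrow> (real^2) set" where
  "foci_locus N x y a = {z. N (z - x) + N (z - y) = 2 * a}"

definition circle_locus :: "(real^2 \<Rightarrow> real) \<Rightarrow> (real^2) set \<Rightarrow> real^2 \<Rightarrow> (real^2) set" where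
  "circle_locus N L x =
     {z. \<exists>\<epsilon>>0. disks_touch (disk N z \<epsilon>) L \<and> x \<in> frontier (disk N z \<epsilon>)}"

definition line_locus :: "(real^2 \<Rightarrow> real) \<Rightarrow> (real^2) set \<Rightarrow> real^2 \<Rightarrow> real \<Rightarrow> (real^2) set" where
  "line_locus N l x \<gamma> =
     {z. \<exists>\<epsilon>>0. x \<in> frontier (disk N z \<epsilon>) \<and> disk_touches_line (disk N z (\<gamma> * \<epsilon>)) l}"

text \<open>
  The \<open>proper\<close> variants leave out the degenerate configurations.

  \<^item> Foci with \<open>2 * a = N (x - y)\<close>: the locus is the metric segment between \<open>x\<close> and \<open>y\<close>
    (the Euclidean segment, if \<open>N\<close> is the Euclidean norm).
  \<^item> \<open>x\<close> on the boundary of the leading circle: in the Euclidean plane the locus is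
    the line through \<open>x\<close> and the centre, without \<open>x\<close>. For \<open>x\<close> at the centre, the locus is a circle.
  \<^item> \<open>x\<close> on the leading line: the locus is empty.
\<close>

definition is_foci_ellipse :: "(real^2 \<Rightarrow> real) \<Rightarrow> (real^2) set \<Rightarrow> bool" where
  "is_foci_ellipse N E \<longleftrightarrow>
     (\<exists>x y a. x \<noteq> y \<and> 2 * a \<ge> N (x - y) \<and> E = foci_locus N x y a)"

definition is_proper_foci_ellipse :: "(real^2 \<Rightarrow> real) \<Rightarrow> (real^2) set \<Rightarrow> bool" where
  "is_proper_foci_ellipse N E \<longleftrightarrow>
     (\<exists>x y a. x \<noteq> y \<and> 2 * a > N (x - y) \<and> E = foci_locus N x y a)"

definition is_proper_circle_ellipse :: "(real^2 \<Rightarrow> real) \<Rightarrow> (real^2) set \<Rightarrow> bool" where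
  "is_proper_circle_ellipse N E \<longleftrightarrow>
     (\<exists>p a x. a > 0 \<and> x \<in> interior (disk N p (2 * a)) \<and> x \<noteq> p \<and>
        E = circle_locus N (disk N p (2 * a)) x)"

definition is_line_ellipse :: "(real^2 \<Rightarrow> real) \<Rightarrow> (real^2) set \<Rightarrow> bool" where
  "is_line_ellipse N E \<longleftrightarrow>
     (\<exists>l x \<gamma>. is_line l \<and> \<gamma> > 1 \<and> E = line_locus N l x \<gamma>)"

definition is_proper_line_ellipse :: "(real^2 \<Rightarrow> real) \<Rightarrow> (real^2) set \<Rightarrow> bool" where
  "is_proper_line_ellipse N E \<longleftrightarrow>
     (\<exists>l x \<gamma>. is_line l \<and> x \<notin> l \<and> \<gamma> > 1 \<and> E = line_locus N l x \<gamma>)"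

end

theory Submission
  imports Defs
begin

text \<open>
  For a focus \<open>x\<close> inside the leading disk of centre \<open>p\<close>, the touching condition can only be inner
  tangency of the smaller disk, which says \<open>N (z - p) + N (z - x) = 2 * a\<close>; so the leading circle is
  centred at the other focus. For the two counterexamples take the maximum norm. A foci ellipse is
  symmetric about the midpoint of its foci, whereas the locus for the line \<open>{z. z$1 = 1}\<close>, the focus
  \<open>0\<close> and \<open>\<gamma> = 2\<close> is a trapezoid. Conversely, the foci ellipse with foci \<open>(\<plusminus>1, 0)\<close> and \<open>a = 2\<close> is an
  octagon with an edge of direction \<open>(1, -1)\<close>. Along that direction the distance to a point has slopes
  \<open>\<plusminus>1\<close>, while on a line locus it is an affine function of slope at most \<open>1 / \<gamma> < 1\<close> in modulus.
\<close>

section \<open>Disks in a normed plane\<close>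

context
  fixes N :: "real^2 \<Rightarrow> real"
  assumes N: "is_norm N"
begin

lemma is_norm_eq_0_iff: "N x = 0 \<longleftrightarrow> x = 0"
  and is_norm_scaleR: "N (c *\<^sub>R x) = \<bar>c\<bar> * N x"
  and is_norm_triangle: "N (x + y) \<le> N x + N y"
  using N unfolding is_norm_def by blast+

lemma is_norm_minus: "N (- x) = N x"
  using is_norm_scaleR[of "-1" x] by simp

lemma is_norm_minus_commute: "N (x - y) = N (y - x)"
  using is_norm_minus[of "x - y"] by simp

lemma is_norm_nonneg: "N x \<ge> 0"
  using is_norm_triangle[of x "- x"] is_norm_minus[of x] is_norm_eq_0_iff[of 0] by simp

lemma is_norm_pos_iff: "N x > 0 \<longleftrightarrow> x \<noteq> 0"
  using is_norm_nonneg[of x] is_norm_eq_0_iff[of x] by linarith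

lemma is_norm_diff_triangle: "N (x - z) \<le> N (x - y) + N (y - z)"
  using is_norm_triangle[of "x - y" "y - z"] by simp

text \<open>Homogeneity and the triangle inequality make \<open>N\<close> convex, and a convex
  function on all of a finite-dimensional space is continuous. This links \<open>N\<close> to the
  standard topology used by \<open>interior\<close> and \<open>frontier\<close>.\<close>

lemma continuous_on_is_norm: "continuous_on UNIV N"
proof (rule convex_on_continuous[OF open_UNIV])
  show "convex_on UNIV N"
  proof (rule convex_onI)
    fix t :: real and x y :: "real^2"
    assume "0 < t" "t < 1"
    then show "N ((1 - t) *\<^sub>R x + t *\<^sub>R y) \<le> (1 - t) * N x + t * N y"
      using is_norm_triangle[of "(1 - t) *\<^sub>R x" "t *\<^sub>R y"] by (simp add: is_norm_scaleR)
  qed simp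
qed

lemma disk_eq:
  assumes "r > 0"
  shows "disk N p r = {z. N (z - p) \<le> r}"
proof (intro set_eqI iffI)
  fix z
  assume "z \<in> disk N p r"
  then obtain k where "N k \<le> 1" "z = p + r *\<^sub>R k"
    unfolding disk_def unit_disk_def by blast
  then show "z \<in> {z. N (z - p) \<le> r}"
    using assms by (simp add: is_norm_scaleR)
next
  fix z
  assume z: "z \<in> {z. N (z - p) \<le> r}"
  let ?k = "(1 / r) *\<^sub>R (z - p)"
  have "N ?k \<le> 1" "z = p + r *\<^sub>R ?k"
    using z assms by (simp_all add: is_norm_scaleR)
  then show "z \<in> disk N p r"
    unfolding disk_def unit_disk_def by blast
qed

lemma continuous_on_is_norm_diff: "continuous_on UNIV (\<lambda>z. N (z - p))"
  by (rule continuous_on_compose2[OF continuous_on_is_norm]) (auto intro!: continuous_intros)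

lemma interior_disk:
  assumes "r > 0"
  shows "interior (disk N p r) = {z. N (z - p) < r}"
proof (rule interior_unique)
  show "{z. N (z - p) < r} \<subseteq> disk N p r"
    by (auto simp: disk_eq[OF assms])
  show "open {z. N (z - p) < r}"
    using continuous_on_is_norm_diff by (intro open_Collect_less continuous_intros) auto
next
  fix T
  assume T: "T \<subseteq> disk N p r" "open T"
  show "T \<subseteq> {z. N (z - p) < r}"
  proof
    fix z
    assume z: "z \<in> T"
    \<comment> \<open>Pushing \<open>z\<close> radially away from \<open>p\<close> keeps it in the
      open set \<open>T\<close> for small \<open>t > 0\<close>, so even
      \<open>(1 + t) * N (z - p)\<close> is at most \<open>r\<close>. Only \<open>z = p\<close> is
      unmoved by the push; there \<open>r > 0\<close> suffices.\<close>
    have lim: "((\<lambda>t. z + t *\<^sub>R (z - p)) \<longlongrightarrow> z + 0 *\<^sub>R (z - p)) (at_right (0::real))"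
      by (intro tendsto_intros)
    then have "eventually (\<lambda>t. z + t *\<^sub>R (z - p) \<in> T) (at_right (0::real))"
      using topological_tendstoD[OF lim T(2)] z by simp
    moreover have "eventually (\<lambda>t::real. t > 0) (at_right 0)"
      by (rule eventually_at_right_less)
    ultimately have "eventually (\<lambda>t. z + t *\<^sub>R (z - p) \<in> T \<and> t > 0) (at_right (0::real))"
      by (rule eventually_conj)
    then obtain t :: real where t: "z + t *\<^sub>R (z - p) \<in> T" "t > 0"
      using eventually_happens'[OF trivial_limit_at_right_real] by blast
    have "z + t *\<^sub>R (z - p) - p = (1 + t) *\<^sub>R (z - p)"
      by (simp add: algebra_simps)
    then have *: "(1 + t) * N (z - p) \<le> r"
      using T(1) t disk_eq[OF assms] by (auto simp: is_norm_scaleR)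
    show "z \<in> {z. N (z - p) < r}"
    proof (cases "N (z - p) = 0")
      case False
      then have "N (z - p) > 0" using is_norm_nonneg[of "z - p"] by linarith
      then have "t * N (z - p) > 0" using t(2) by simp
      with * show ?thesis by (simp add: algebra_simps)
    qed (use assms in simp)
  qed
qed

lemma frontier_disk:
  assumes "r > 0"
  shows "frontier (disk N p r) = {z. N (z - p) = r}"
proof -
  have "closed (disk N p r)"
    unfolding disk_eq[OF assms]
    using continuous_on_is_norm_diff by (intro closed_Collect_le continuous_intros) auto
  then show ?thesis
    unfolding frontier_def interior_disk[OF assms] closure_closed[OF \<open>closed _\<close>]
    using disk_eq[OF assms] by auto
qed

section \<open>Ellipses by leading circle and by foci\<close>

text \<open>Going on from \<open>z\<close> by \<open>r\<close> in the direction from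
  \<open>p\<close> to \<open>z\<close> turns the triangle inequality into an equality. If
  \<open>z = p\<close>, any unit vector serves as the direction.\<close>

lemma farthest_point_in_disk:
  assumes "r > 0"
  obtains w where "N (w - z) = r" "N (w - p) = N (z - p) + r"
proof -
  obtain u where u: "N u = 1" "z - p = N (z - p) *\<^sub>R u"
  proof (cases "z = p")
    case True
    let ?e = "axis 1 1 :: real^2"
    have "N ?e > 0" by (simp add: is_norm_pos_iff axis_eq_0_iff)
    then have "N ((1 / N ?e) *\<^sub>R ?e) = 1" by (simp add: is_norm_scaleR)
    moreover have "z - p = N (z - p) *\<^sub>R ((1 / N ?e) *\<^sub>R ?e)"
      using True is_norm_eq_0_iff[of 0] by simp
    ultimately show ?thesis by (rule that)
  next
    case False
    then have "N (z - p) > 0" by (simp add: is_norm_pos_iff)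
    then show ?thesis
      by (intro that[of "(1 / N (z - p)) *\<^sub>R (z - p)"]) (simp_all add: is_norm_scaleR)
  qed
  have "N (z + r *\<^sub>R u - z) = r"
    using u(1) assms by (simp add: is_norm_scaleR)
  moreover have "z + r *\<^sub>R u - p = (N (z - p) + r) *\<^sub>R u"
    using u(2) by (simp add: algebra_simps)
  then have "N (z + r *\<^sub>R u - p) = N (z - p) + r"
    using u(1) assms is_norm_nonneg[of "z - p"] by (simp add: is_norm_scaleR)
  ultimately show ?thesis by (rule that)
qed

text \<open>The point of the inner disk farthest from \<open>p\<close> forces the bound; the
  triangle inequality gives the converse.\<close>

lemma disk_subset_disk_iff:
  assumes "r > 0" "s > 0"
  shows "disk N z r \<subseteq> disk N p s \<longleftrightarrow> N (z - p) + r \<le> s"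
proof
  assume sub: "disk N z r \<subseteq> disk N p s"
  obtain w where "N (w - z) = r" "N (w - p) = N (z - p) + r"
    using farthest_point_in_disk[OF assms(1)] .
  then show "N (z - p) + r \<le> s"
    using sub assms by (force simp: disk_eq)
next
  assume le: "N (z - p) + r \<le> s"
  show "disk N z r \<subseteq> disk N p s"
  proof
    fix w
    assume "w \<in> disk N z r"
    then show "w \<in> disk N p s"
      using assms le is_norm_diff_triangle[of w p z] by (simp add: disk_eq)
  qed
qed

text \<open>Moving \<open>x\<close> slightly towards \<open>z\<close> enters the small disk's
  interior without leaving the open set \<open>interior L\<close>. This rules out outer tangency
  when the focus is inside the leading disk.\<close>

lemma interiors_meet_at_frontier_point:
  assumes "r > 0" "x \<in> frontier (disk N z r)" "x \<in> interior L"
  shows "interior (disk N z r) \<inter> interior L \<noteq> {}"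
proof -
  have x: "N (x - z) = r"
    using assms by (simp add: frontier_disk)
  have lim: "((\<lambda>t. x - t *\<^sub>R (x - z)) \<longlongrightarrow> x - 0 *\<^sub>R (x - z)) (at_right (0::real))"
    by (intro tendsto_intros)
  then have "eventually (\<lambda>t. x - t *\<^sub>R (x - z) \<in> interior L) (at_right (0::real))"
    using topological_tendstoD[OF lim open_interior] assms(3) by simp
  moreover have "eventually (\<lambda>t::real. t \<in> {0<..<1}) (at_right 0)"
    by (rule eventually_at_right_real) simp
  ultimately have "eventually (\<lambda>t. x - t *\<^sub>R (x - z) \<in> interior L \<and> t \<in> {0<..<1}) (at_right (0::real))"
    by (rule eventually_conj)
  then obtain t :: real where t: "x - t *\<^sub>R (x - z) \<in> interior L" "0 < t" "t < 1"
    using eventually_happens'[OF trivial_limit_at_right_real] by fastforce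
  have "x - t *\<^sub>R (x - z) - z = (1 - t) *\<^sub>R (x - z)"
    by (simp add: algebra_simps)
  then have "N (x - t *\<^sub>R (x - z) - z) < r"
    using t x assms(1) by (simp add: is_norm_scaleR)
  then show ?thesis
    using t(1) assms(1) by (auto simp: interior_disk)
qed

theorem circle_locus_eq_foci_locus:
  assumes "a > 0" "x \<in> interior (disk N p (2 * a))"
  shows "circle_locus N (disk N p (2 * a)) x = foci_locus N p x a"
proof (intro set_eqI iffI)
  have a: "2 * a > 0" using assms(1) by simp
  have xp: "N (x - p) < 2 * a" using assms by (simp add: interior_disk)
  fix z
  {
    assume "z \<in> circle_locus N (disk N p (2 * a)) x"
    then obtain e where e: "e > 0" "disks_touch (disk N z e) (disk N p (2 * a))"
        "x \<in> frontier (disk N z e)"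
      unfolding circle_locus_def by blast
    have xz: "N (x - z) = e" using e by (simp add: frontier_disk)
    obtain w where w: "N (w - z) = e" "N (w - p) = 2 * a"
      using e(1,2) a unfolding disks_touch_def by (auto simp: frontier_disk)
    have "interior (disk N z e) \<inter> interior (disk N p (2 * a)) \<noteq> {}"
      using interiors_meet_at_frontier_point[OF e(1,3) assms(2)] .
    \<comment> \<open>Otherwise \<open>2 * a + N (p - z)\<close> would be at most
      \<open>e = N (x - z)\<close>, hence at most \<open>N (x - p) + N (p - z)\<close>, although
      \<open>N (x - p) < 2 * a\<close>.\<close>
    moreover have "\<not> disk N p (2 * a) \<subseteq> disk N z e"
      using disk_subset_disk_iff[OF a e(1)] xp xz is_norm_diff_triangle[of x z p] by simp
    ultimately have "disk N z e \<subseteq> disk N p (2 * a)"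
      using e(2) unfolding disks_touch_def by blast
    then have "N (z - p) + e \<le> 2 * a"
      using disk_subset_disk_iff[OF e(1) a] by simp
    \<comment> \<open>Containment bounds the sum from above; the common boundary point
      \<open>w\<close> bounds it from below.\<close>
    moreover have "2 * a \<le> N (z - p) + e"
      using is_norm_diff_triangle[of w p z] w by simp
    ultimately show "z \<in> foci_locus N p x a"
      using xz is_norm_minus_commute[of x z] unfolding foci_locus_def by simp
  }
  {
    assume "z \<in> foci_locus N p x a"
    then have z: "N (z - p) + N (z - x) = 2 * a"
      unfolding foci_locus_def by simp
    let ?e = "N (x - z)"
    have zx: "N (z - x) = ?e" by (rule is_norm_minus_commute)
    \<comment> \<open>At \<open>z = x\<close> the foci equation would put \<open>x\<close> on the
      leading circle. Hence the touching disk has positive radius.\<close>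
    have "z \<noteq> x" using z xp is_norm_eq_0_iff[of 0] by auto
    then have e: "?e > 0" by (simp add: is_norm_pos_iff)
    \<comment> \<open>The point of the small disk farthest from \<open>p\<close> lies at distance
      \<open>2 * a\<close> from \<open>p\<close>, so it is a point of tangency.\<close>
    obtain w where "N (w - z) = ?e" "N (w - p) = N (z - p) + ?e"
      using farthest_point_in_disk[OF e] .
    then have "w \<in> frontier (disk N z ?e) \<inter> frontier (disk N p (2 * a))"
      using z zx e a by (simp add: frontier_disk)
    moreover have "disk N z ?e \<subseteq> disk N p (2 * a)"
      using disk_subset_disk_iff[OF e a] z zx by simp
    ultimately have "disks_touch (disk N z ?e) (disk N p (2 * a))"
      unfolding disks_touch_def by blast
    moreover have "x \<in> frontier (disk N z ?e)"
      using e by (simp add: frontier_disk)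
    ultimately show "z \<in> circle_locus N (disk N p (2 * a)) x"
      using e unfolding circle_locus_def by blast
  }
qed

lemma proper_circle_ellipse_iff_proper_foci_ellipse:
  "is_proper_circle_ellipse N E \<longleftrightarrow> is_proper_foci_ellipse N E"
proof
  assume "is_proper_circle_ellipse N E"
  then obtain p a x where *: "a > 0" "x \<in> interior (disk N p (2 * a))" "x \<noteq> p"
      "E = circle_locus N (disk N p (2 * a)) x"
    unfolding is_proper_circle_ellipse_def by blast
  have "N (p - x) < 2 * a"
    using *(1,2) is_norm_minus_commute[of p x] by (simp add: interior_disk)
  then show "is_proper_foci_ellipse N E"
    unfolding is_proper_foci_ellipse_def
    using *(3,4) circle_locus_eq_foci_locus[OF *(1,2)] by metis
next
  assume "is_proper_foci_ellipse N E"
  then obtain x y a where *: "x \<noteq> y" "2 * a > N (x - y)" "E = foci_locus N x y a"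
    unfolding is_proper_foci_ellipse_def by blast
  have a: "a > 0" using *(2) is_norm_nonneg[of "x - y"] by linarith
  have y: "y \<in> interior (disk N x (2 * a))"
    using *(2) a is_norm_minus_commute[of x y] by (simp add: interior_disk)
  show "is_proper_circle_ellipse N E"
    unfolding is_proper_circle_ellipse_def
    using *(1,3) a y circle_locus_eq_foci_locus[OF a y] by metis
qed

text \<open>Reflection in the midpoint of \<open>x\<close> and \<open>y\<close> swaps the two
  distances.\<close>

lemma foci_locus_symmetric:
  assumes "z \<in> foci_locus N x y a"
  shows "x + y - z \<in> foci_locus N x y a"
  using assms is_norm_minus_commute[of y z] is_norm_minus_commute[of x z]
  unfolding foci_locus_def by simp

end

section \<open>Line loci in the maximum norm\<close>

definition max_norm :: "real^2 \<Rightarrow> real" where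
  "max_norm v = max \<bar>v$1\<bar> \<bar>v$2\<bar>"

lemma is_norm_max_norm: "is_norm max_norm"
  unfolding is_norm_def max_norm_def
  by (auto simp: vec_eq_iff forall_2 abs_mult max_mult_distrib_left)

lemma inner_real2: "(b::real^2) \<bullet> v = b$1 * v$1 + b$2 * v$2"
  by (simp add: inner_vec_def sum_2)

text \<open>The factor is the dual norm of \<open>b\<close>, the sum norm.\<close>

lemma abs_inner_le_max_norm: "\<bar>b \<bullet> v\<bar> \<le> (\<bar>b$1\<bar> + \<bar>b$2\<bar>) * max_norm v"
proof -
  have "\<bar>b \<bullet> v\<bar> \<le> \<bar>b$1\<bar> * \<bar>v$1\<bar> + \<bar>b$2\<bar> * \<bar>v$2\<bar>"
    unfolding inner_real2 abs_mult[symmetric] by (rule abs_triangle_ineq)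
  also have "\<dots> \<le> \<bar>b$1\<bar> * max_norm v + \<bar>b$2\<bar> * max_norm v"
    by (intro add_mono mult_left_mono) (auto simp: max_norm_def)
  finally show ?thesis by (simp add: algebra_simps)
qed

lemma sum_abs_pos: "(b::real^2) \<noteq> 0 \<Longrightarrow> \<bar>b$1\<bar> + \<bar>b$2\<bar> > 0"
  by (auto simp: vec_eq_iff forall_2)

text \<open>The dual-norm bound is attained in the direction of the sign vector of \<open>b\<close>,
  so moving from \<open>z\<close> along it reaches the line as early as possible.\<close>

lemma hyperplane_nearest_point_max_norm:
  assumes "b \<noteq> 0"
  obtains w where "b \<bullet> w = c" "(\<bar>b$1\<bar> + \<bar>b$2\<bar>) * max_norm (w - z) \<le> \<bar>b \<bullet> z - c\<bar>"
proof -
  let ?B = "\<bar>b$1\<bar> + \<bar>b$2\<bar>"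
  note B = sum_abs_pos[OF assms]
  define t where "t = (c - b \<bullet> z) / ?B"
  define s :: "real^2" where "s = vector [sgn (b$1), sgn (b$2)]"
  have "b \<bullet> s = ?B"
    by (simp add: inner_real2 s_def abs_sgn)
  then have "b \<bullet> (z + t *\<^sub>R s) = c"
    using B by (simp add: inner_add_right t_def)
  moreover have "max_norm s \<le> 1"
    by (simp add: max_norm_def s_def abs_sgn_eq)
  then have "?B * max_norm (z + t *\<^sub>R s - z) \<le> ?B * \<bar>t\<bar>"
    using B is_norm_scaleR[OF is_norm_max_norm, of t s]
    by (simp add: mult_left_le)
  moreover have "?B * \<bar>t\<bar> = \<bar>b \<bullet> z - c\<bar>"
    using B by (simp add: t_def abs_divide abs_minus_commute)
  ultimately show ?thesis using that by simp
qed

text \<open>Dividing by the dual norm of \<open>b\<close> turns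
  \<open>\<bar>b \<bullet> z - c\<bar>\<close> into the distance from \<open>z\<close> to the line,
  and a disk touches the line exactly when its radius is that distance.\<close>

lemma disk_touches_hyperplane_max_norm_iff:
  assumes "r > 0" "b \<noteq> 0"
  shows "disk_touches_line (disk max_norm z r) {w. b \<bullet> w = c} \<longleftrightarrow>
           \<bar>b \<bullet> z - c\<bar> = (\<bar>b$1\<bar> + \<bar>b$2\<bar>) * r"
proof -
  let ?B = "\<bar>b$1\<bar> + \<bar>b$2\<bar>"
  note B = sum_abs_pos[OF assms(2)]
  obtain w where w: "b \<bullet> w = c" "?B * max_norm (w - z) \<le> \<bar>b \<bullet> z - c\<bar>"
    using hyperplane_nearest_point_max_norm[OF assms(2)] .
  have le: "\<bar>b \<bullet> z - c\<bar> \<le> ?B * max_norm (v - z)" if "b \<bullet> v = c" for v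
    using abs_inner_le_max_norm[of b "v - z"] that
    by (simp add: inner_diff_right abs_minus_commute)
  have "disk max_norm z r \<inter> {w. b \<bullet> w = c} \<noteq> {} \<longleftrightarrow> \<bar>b \<bullet> z - c\<bar> \<le> ?B * r"
  proof
    assume "disk max_norm z r \<inter> {w. b \<bullet> w = c} \<noteq> {}"
    then obtain v where v: "b \<bullet> v = c" "max_norm (v - z) \<le> r"
      using disk_eq[OF is_norm_max_norm assms(1)] by auto
    show "\<bar>b \<bullet> z - c\<bar> \<le> ?B * r"
      using le[OF v(1)] mult_left_mono[OF v(2), of ?B] B by linarith
  next
    assume "\<bar>b \<bullet> z - c\<bar> \<le> ?B * r"
    then have "?B * max_norm (w - z) \<le> ?B * r" using w(2) by linarith
    then have "max_norm (w - z) \<le> r" using B by simp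
    then show "disk max_norm z r \<inter> {w. b \<bullet> w = c} \<noteq> {}"
      using w(1) disk_eq[OF is_norm_max_norm assms(1)] by auto
  qed
  moreover have "interior (disk max_norm z r) \<inter> {w. b \<bullet> w = c} = {} \<longleftrightarrow> \<not> \<bar>b \<bullet> z - c\<bar> < ?B * r"
  proof -
    have "interior (disk max_norm z r) \<inter> {w. b \<bullet> w = c} \<noteq> {} \<longleftrightarrow> \<bar>b \<bullet> z - c\<bar> < ?B * r"
    proof
      assume "interior (disk max_norm z r) \<inter> {w. b \<bullet> w = c} \<noteq> {}"
      then obtain v where v: "b \<bullet> v = c" "max_norm (v - z) < r"
        using interior_disk[OF is_norm_max_norm assms(1)] by auto
      show "\<bar>b \<bullet> z - c\<bar> < ?B * r"
        using le[OF v(1)] mult_strict_left_mono[OF v(2) B] by linarith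
    next
      assume "\<bar>b \<bullet> z - c\<bar> < ?B * r"
      then have "?B * max_norm (w - z) < ?B * r" using w(2) by linarith
      then have "max_norm (w - z) < r" using B by simp
      then show "interior (disk max_norm z r) \<inter> {w. b \<bullet> w = c} \<noteq> {}"
        using w(1) interior_disk[OF is_norm_max_norm assms(1)] by auto
    qed
    then show ?thesis by blast
  qed
  ultimately show ?thesis
    unfolding disk_touches_line_def by auto
qed

text \<open>This is the focus-directrix equation: the distance to the line is
  \<open>\<gamma>\<close> times the distance to the focus. The condition \<open>z \<noteq> x\<close>
  reflects the positive radius.\<close>

lemma mem_line_locus_max_norm_iff:
  assumes "\<gamma> > 1" "b \<noteq> 0"
  shows "z \<in> line_locus max_norm {w. b \<bullet> w = c} x \<gamma> \<longleftrightarrow>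
           z \<noteq> x \<and> \<bar>b \<bullet> z - c\<bar> = (\<bar>b$1\<bar> + \<bar>b$2\<bar>) * (\<gamma> * max_norm (z - x))"
proof -
  have "z \<in> line_locus max_norm {w. b \<bullet> w = c} x \<gamma> \<longleftrightarrow>
          (\<exists>e>0. max_norm (x - z) = e \<and> \<bar>b \<bullet> z - c\<bar> = (\<bar>b$1\<bar> + \<bar>b$2\<bar>) * (\<gamma> * e))"
    using assms unfolding line_locus_def
    by (auto simp: frontier_disk[OF is_norm_max_norm] disk_touches_hyperplane_max_norm_iff)
  also have "\<dots> \<longleftrightarrow> max_norm (z - x) > 0 \<and>
               \<bar>b \<bullet> z - c\<bar> = (\<bar>b$1\<bar> + \<bar>b$2\<bar>) * (\<gamma> * max_norm (z - x))"
    by (auto simp: is_norm_minus_commute[OF is_norm_max_norm, of x z])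
  finally show ?thesis
    by (simp add: is_norm_pos_iff[OF is_norm_max_norm])
qed

lemma is_line_iff_hyperplane: "is_line l \<longleftrightarrow> (\<exists>b c. b \<noteq> 0 \<and> l = {z. b \<bullet> z = c})"
proof -
  have "is_line l \<longleftrightarrow> affine l \<and> (\<exists>b c. b \<noteq> 0 \<and> affine hull l = {z. b \<bullet> z = c})"
    using aff_dim_eq_hyperplane[of l] unfolding is_line_def by simp
  also have "\<dots> \<longleftrightarrow> (\<exists>b c. b \<noteq> 0 \<and> l = {z. b \<bullet> z = c})"
    using affine_hull_eq[of l] affine_hyperplane by metis
  finally show ?thesis .
qed

text \<open>As \<open>\<gamma> > 1\<close>, the point \<open>z\<close> is closer to \<open>x\<close>
  than to the line, so the line cannot separate them. This later removes the absolute value from the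
  focus-directrix equation.\<close>

lemma line_locus_max_norm_same_side:
  assumes "\<gamma> > 1" "b \<noteq> 0" "z \<in> line_locus max_norm {w. b \<bullet> w = c} x \<gamma>"
  shows "(b \<bullet> z - c) * (b \<bullet> x - c) > 0"
proof -
  let ?B = "\<bar>b$1\<bar> + \<bar>b$2\<bar>"
  have z: "z \<noteq> x" "\<bar>b \<bullet> z - c\<bar> = ?B * (\<gamma> * max_norm (z - x))"
    using assms mem_line_locus_max_norm_iff by blast+
  have "max_norm (z - x) > 0"
    using z(1) by (simp add: is_norm_pos_iff[OF is_norm_max_norm])
  then have "?B * max_norm (z - x) < ?B * (\<gamma> * max_norm (z - x))"
    using assms(1) sum_abs_pos[OF assms(2)] by simp
  then have "\<bar>(b \<bullet> z - c) - (b \<bullet> x - c)\<bar> < \<bar>b \<bullet> z - c\<bar>"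
    using abs_inner_le_max_norm[of b "z - x"] z(2) by (simp add: inner_diff_right)
  then show ?thesis
    by (auto simp: zero_less_mult_iff abs_if split: if_splits)
qed

section \<open>The two counterexamples\<close>

lemma trapezoid_not_foci_ellipse:
  defines "l \<equiv> {w::real^2. axis 1 1 \<bullet> w = 1}"
  shows "is_proper_line_ellipse max_norm (line_locus max_norm l 0 2)"
    and "\<not> is_foci_ellipse max_norm (line_locus max_norm l 0 2)"
proof -
  let ?E = "line_locus max_norm l 0 2"
  let ?e = "axis 1 1 :: real^2"
  have "?e \<noteq> 0" by (simp add: axis_eq_0_iff)
  then have "is_line l"
    unfolding is_line_iff_hyperplane l_def by blast
  moreover have "0 \<notin> l" by (simp add: l_def)
  ultimately show "is_proper_line_ellipse max_norm ?E"
    unfolding is_proper_line_ellipse_def by (metis one_less_numeral_iff semiring_norm(76))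
  have mem: "z \<in> ?E \<longleftrightarrow> z \<noteq> 0 \<and> \<bar>z$1 - 1\<bar> = 2 * max \<bar>z$1\<bar> \<bar>z$2\<bar>" for z
    unfolding l_def using mem_line_locus_max_norm_iff[OF _ \<open>?e \<noteq> 0\<close>, of 2 z 1 0]
    by (simp add: inner_real2 max_norm_def axis_def)
  have bounds: "- 1 \<le> z$1 \<and> z$1 \<le> 1/3 \<and> \<bar>z$2\<bar> \<le> (1 - z$1) / 2" if "z \<in> ?E" for z
    using that unfolding mem by (auto simp: abs_if max_def split: if_splits)
  \<comment> \<open>Three vertices of the trapezoid: both ends of its left side, of length 2, and
    one end of its right side, of length 2/3.\<close>
  have pts: "vector [-1, 1] \<in> ?E" "vector [-1, -1] \<in> ?E" "vector [1/3, 1/3] \<in> ?E"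
    unfolding mem by (simp_all add: vec_eq_iff forall_2)
  show "\<not> is_foci_ellipse max_norm ?E"
  proof
    assume "is_foci_ellipse max_norm ?E"
    then obtain x y a where E: "?E = foci_locus max_norm x y a"
      unfolding is_foci_ellipse_def by blast
    have sym: "x + y - z \<in> ?E" if "z \<in> ?E" for z
      using that foci_locus_symmetric[OF is_norm_max_norm] unfolding E by blast
    \<comment> \<open>The bounds on the first coordinate force the reflection to map the left side
      into the line of the right side, where \<open>bounds\<close> leaves room for length 2/3
      only.\<close>
    show False
      using pts[THEN sym, THEN bounds] by (auto simp: abs_if field_simps split: if_splits)
  qed
qed

lemma octagon_not_line_ellipse:
  defines "E \<equiv> foci_locus max_norm (vector [1, 0]) (vector [-1, 0]) 2"
  shows "is_proper_foci_ellipse max_norm E" and "\<not> is_line_ellipse max_norm E"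
proof -
  have "(vector [1, 0] :: real^2) \<noteq> vector [-1, 0]"
    by (simp add: vec_eq_iff forall_2)
  moreover have "2 * 2 > max_norm (vector [1, 0] - vector [-1, 0])"
    by (simp add: max_norm_def)
  ultimately show "is_proper_foci_ellipse max_norm E"
    unfolding is_proper_foci_ellipse_def E_def by blast
  \<comment> \<open>\<open>P\<close> runs along the octagon's edge from (1, 2) at
    \<open>t = -1/2\<close> to (2, 1) at \<open>t = 1/2\<close>.\<close>
  define P :: "real \<Rightarrow> real^2" where "P t = vector [3/2 + t, 3/2 - t]" for t
  have P: "P (-1/2) \<in> E" "P 0 \<in> E" "P (1/2) \<in> E"
    by (simp_all add: E_def foci_locus_def max_norm_def P_def)
  show "\<not> is_line_ellipse max_norm E"
  proof
    assume "is_line_ellipse max_norm E"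
    then obtain b c x \<gamma> where b: "b \<noteq> 0" and \<gamma>: "\<gamma> > 1"
        and E: "E = line_locus max_norm {w. b \<bullet> w = c} x \<gamma>"
      unfolding is_line_ellipse_def is_line_iff_hyperplane by metis
    let ?B = "\<bar>b$1\<bar> + \<bar>b$2\<bar>"
    define \<sigma> where "\<sigma> = sgn (b \<bullet> x - c)"
    define k where "k = ?B * \<gamma>"
    have k: "k > ?B" "k > 0"
      using sum_abs_pos[OF b] \<gamma> by (simp_all add: k_def)
    have dist: "k * max_norm (z - x) = \<sigma> * (b \<bullet> z - c)" if "z \<in> E" for z
    proof -
      have "\<bar>b \<bullet> z - c\<bar> = k * max_norm (z - x)"
        using that mem_line_locus_max_norm_iff[OF \<gamma> b] unfolding E k_def by simp
      moreover have "sgn (b \<bullet> z - c) = \<sigma>"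
        using line_locus_max_norm_same_side[OF \<gamma> b] that unfolding E \<sigma>_def
        by (force simp: zero_less_mult_iff)
      then have "\<bar>b \<bullet> z - c\<bar> = \<sigma> * (b \<bullet> z - c)"
        by (metis abs_sgn mult.commute)
      ultimately show ?thesis by simp
    qed
    \<comment> \<open>Slope and value at \<open>t = 0\<close> of the affine function
      \<open>\<sigma> * (b \<bullet> P t - c) / k\<close>, which is the distance to \<open>x\<close>
      wherever \<open>P t\<close> lies in \<open>E\<close>.\<close>
    define s where "s = \<sigma> * (b$1 - b$2) / k"
    define q where "q = \<sigma> * (3/2 * (b$1 + b$2) - c) / k"
    have affine: "max_norm (P t - x) = q + s * t" if "P t \<in> E" for t
    proof -
      have "b \<bullet> P t - c = (3/2 * (b$1 + b$2) - c) + (b$1 - b$2) * t"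
        by (simp add: P_def inner_real2 algebra_simps)
      moreover have "k * q = \<sigma> * (3/2 * (b$1 + b$2) - c)" "k * s = \<sigma> * (b$1 - b$2)"
        using k(2) by (simp_all add: s_def q_def)
      then have "k * (q + s * t) = \<sigma> * ((3/2 * (b$1 + b$2) - c) + (b$1 - b$2) * t)"
        unfolding distrib_left mult.assoc[symmetric] by simp
      ultimately have "k * max_norm (P t - x) = k * (q + s * t)"
        using dist[OF that] by simp
      then show ?thesis using k(2) by simp
    qed
    have "\<bar>\<sigma>\<bar> \<le> 1" by (simp add: \<sigma>_def abs_sgn_eq)
    then have "\<bar>\<sigma> * (b$1 - b$2)\<bar> \<le> \<bar>b$1 - b$2\<bar>"
      unfolding abs_mult by (rule mult_left_le_one_le[OF abs_ge_zero abs_ge_zero])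
    also have "\<dots> < k" using k(1) by linarith
    finally have "\<bar>s\<bar> < 1" using k(2) by (simp add: s_def abs_divide)
    \<comment> \<open>A coordinate of \<open>P t - x\<close> attaining the maximum at
      \<open>t = 0\<close> grows in modulus by 1/2 towards one of \<open>t = -1/2\<close> and
      \<open>t = 1/2\<close>, whereas \<open>q + s * t\<close> changes by less than 1/2.\<close>
    with P[THEN affine] show False
      by (auto simp: max_norm_def P_def max_def abs_if split: if_splits)
  qed
qed

theorem proposition1:
  shows "(\<forall>N. is_norm N \<longrightarrow>
            (\<forall>E. is_proper_foci_ellipse N E \<longrightarrow> is_proper_circle_ellipse N E) \<and>
            (\<forall>E. is_proper_circle_ellipse N E \<longrightarrow> is_proper_foci_ellipse N E) \<and>
            (\<forall>p a. a > 0 \<longrightarrow> circle_locus N (disk N p (2 * a)) p = foci_locus N p p a)) \<and>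
         (\<exists>N E. is_norm N \<and> is_proper_line_ellipse N E \<and> \<not> is_foci_ellipse N E) \<and>
         (\<exists>N E. is_norm N \<and> is_proper_foci_ellipse N E \<and> \<not> is_line_ellipse N E)"
proof (intro conjI allI impI)
  fix N p and a :: real
  assume N: "is_norm N" and a: "a > 0"
  \<comment> \<open>A focus at the centre falls outside both proper notions, but the tangency
    argument covers it, with both foci at \<open>p\<close>.\<close>
  have "p \<in> interior (disk N p (2 * a))"
    using a is_norm_eq_0_iff[OF N, of 0] by (simp add: interior_disk[OF N])
  then show "circle_locus N (disk N p (2 * a)) p = foci_locus N p p a"
    by (rule circle_locus_eq_foci_locus[OF N a])
next
  show "\<exists>N E. is_norm N \<and> is_proper_line_ellipse N E \<and> \<not> is_foci_ellipse N E"
    using is_norm_max_norm trapezoid_not_foci_ellipse by blast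
  show "\<exists>N E. is_norm N \<and> is_proper_foci_ellipse N E \<and> \<not> is_line_ellipse N E"
    using is_norm_max_norm octagon_not_line_ellipse by blast
qed (simp_all add: proper_circle_ellipse_iff_proper_foci_ellipse)

end
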